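(* Let $1\le k<N$, let $V_k$ be the matrix formed by the top $k$ (column) eigenvectors of $A$ and $\tilde V_k$ the matrix formed by the top $k$ eigenvectors of $\tilde A$, and let $\alpha>0$. If $\lambda_k-\lambda_{k+1}\ge\alpha$ and $\lambda_k\ge\alpha$, then there is a unitary $k\times k$ matrix $Q$ such that $$\|\tilde V_k-V_kQ\|_2\le(1+\sqrt2)\,\frac1\alpha\,\|A-\tilde A\|_F .$$
   Context: Let $\sigma>0$, let $x_1,\dots,x_N$ be data points in a Euclidean space, and let $\tilde x_1,\dots,\tilde x_N$ be perturbed data points, also in a Euclidean space (possibly of different dimension). Define the $N\times N$ matrices $W_{i,j}=\exp\left(-\frac{\|x_i-x_j\|_2^2}{2\sigma}\right)$ and $\tilde W_{i,j}=\exp\left(-\frac{\|\tilde x_i-\tilde x_j\|_2^2}{2\sigma}\right)$, the diagonal matrices $D_{i,i}=\sum_{l=1}^N W_{i,l}$ and $\tilde D_{i,i}=\sum_{l=1}^N\tilde W_{i,l}$, and the real symmetric affinity matrices $A=D^{-1/2}WD^{-1/2}$ and $\tilde A=\tilde D^{-1/2}\tilde W\tilde D^{-1/2}$. Let $\lambda_1\ge\lambda_2\ge\dots\ge\lambda_N$ be the eigenvalues of $A$ with corresponding orthonormal eigenvectors $v_1,\dots,v_N$, and let $\tilde v_1,\dots,\tilde v_N$ be orthonormal eigenvectors of $\tilde A$, ordered by decreasing eigenvalue. Put $V_k=[v_1,\dots,v_k]\in\mathbb{R}^{N\times k}$ and $\tilde V_k=[\tilde v_1,\dots,\tilde v_k]\in\mathbb{R}^{N\times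 k}$. For matrices, $\|\cdot\|_2$ is the spectral norm and $\|\cdot\|_F$ the Frobenius norm. *)

theory Defs
  imports
    "HOL-Analysis.Euclidean_Space"
    "HOL-Analysis.L2_Norm"
    "Jordan_Normal_Form.Schur_Decomposition"
begin

(* All families (data points, eigenvalues, eigenvectors) are indexed from 0,
   like the entries of matrices and vectors, so index i here is i + 1 in the
   usual 1-based numbering. *)

definition gauss_weight_mat ::
    "real \<Rightarrow> nat \<Rightarrow> (nat \<Rightarrow> 'a::euclidean_space) \<Rightarrow> real mat" where
  "gauss_weight_mat \<sigma> N x =
     Matrix.mat N N (\<lambda>(i, j). exp (- ((norm (x i - x j))\<^sup>2 / (2 * \<sigma>))))"

definition degree_mat :: "real mat \<Rightarrow> real mat" where
  "degree_mat W = mat_diag (dim_row W) (\<lambda>i. \<Sum>l<dim_col W. W $$ (i, l))"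

(* The power D^(-1/2) of a diagonal matrix D with positive diagonal entries. *)
definition diag_inv_sqrt :: "real mat \<Rightarrow> real mat" where
  "diag_inv_sqrt D = mat_diag (dim_row D) (\<lambda>i. (D $$ (i, i)) powr (- (1 / 2)))"

definition affinity_mat ::
    "real \<Rightarrow> nat \<Rightarrow> (nat \<Rightarrow> 'a::euclidean_space) \<Rightarrow> real mat" where
  "affinity_mat \<sigma> N x =
     (let W = gauss_weight_mat \<sigma> N x; R = diag_inv_sqrt (degree_mat W) in R * W * R)"

(* For an n x n matrix A: v 0, ..., v (n - 1) is an orthonormal basis of
   eigenvectors, with eigenvalues l 0 \<ge> ... \<ge> l (n - 1). Hence l lists the
   spectrum of A with multiplicities. Values at indices from n on are irrelevant. *)
definition ordered_orthonormal_eigenbasis ::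
    "real mat \<Rightarrow> (nat \<Rightarrow> real) \<Rightarrow> (nat \<Rightarrow> real vec) \<Rightarrow> bool" where
  "ordered_orthonormal_eigenbasis A l v \<longleftrightarrow>
     (\<forall>i<dim_row A. eigenvector A (v i) (l i)) \<and>
     (\<forall>i<dim_row A. \<forall>j<dim_row A. scalar_prod (v i) (v j) = (if i = j then 1 else 0)) \<and>
     (\<forall>i j. i \<le> j \<and> j < dim_row A \<longrightarrow> l j \<le> l i)"

definition top_eigvec_mat :: "nat \<Rightarrow> nat \<Rightarrow> (nat \<Rightarrow> real vec) \<Rightarrow> real mat" where
  "top_eigvec_mat N k v = mat_of_cols N (map v [0..<k])"

definition unitary_mat :: "nat \<Rightarrow> 'a::conjugatable_field mat \<Rightarrow> bool" where
  "unitary_mat n Q \<longleftrightarrow>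
     Q \<in> carrier_mat n n \<and> mat_adjoint Q * Q = 1\<^sub>m n \<and> Q * mat_adjoint Q = 1\<^sub>m n"

definition l2_vec_norm :: "real vec \<Rightarrow> real" where
  "l2_vec_norm v = L2_set (\<lambda>i. v $ i) {..<dim_vec v}"

definition frobenius_norm :: "real mat \<Rightarrow> real" where
  "frobenius_norm M = L2_set (\<lambda>ij. M $$ ij) ({..<dim_row M} \<times> {..<dim_col M})"

(* The operator norm induced by the Euclidean norms. Taking the supremum over the
   closed unit ball rather than the unit sphere keeps the set nonempty when M has
   no columns. *)
definition spectral_norm :: "real mat \<Rightarrow> real" where
  "spectral_norm M =
     (SUP u \<in> {u \<in> carrier_vec (dim_col M). l2_vec_norm u \<le> 1}. l2_vec_norm (M *\<^sub>v u))"

end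

theory Submission
  imports Defs "HOL-Analysis.Function_Topology" "HOL-Analysis.Convex"
begin

text \<open>
  The bound is a Davis--Kahan theorem for two symmetric matrices, with the spectral gap placed
  in the unperturbed one. The argument yields the constant \<open>2\<close>, which is at most \<open>1 + sqrt 2\<close>.

  Put \<open>c i j = (v i \<bullet> v' j)\<^sup>2\<close>. As both families are orthonormal bases, this matrix is
  doubly stochastic, so its two off-diagonal blocks (\<open>i < k \<le> j\<close> and \<open>j < k \<le> i\<close>) carry the
  same mass \<open>s\<close>, which is the sum of the squared sines of the principal angles between the two
  top eigenspaces. Two inequalities for \<open>s\<close> give the result.

  \<^item> In the two eigenbases the difference \<open>A - A'\<close> has the entries
    \<open>(l i - l' j) * (v i \<bullet> v' j)\<close>, hence its squared Frobenius norm is the sum of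
    \<open>(l i - l' j)\<^sup>2 * c i j\<close> (\<open>eigenbasis_perturbation_identity\<close>). The first block
    contributes at least \<open>p\<^sup>2 * s\<close> and the second at least \<open>q\<^sup>2 * s\<close>, where \<open>p\<close> and \<open>q\<close> are
    the amounts (\<open>0\<close> if negative) by which the threshold \<open>l' k\<close> lies below \<open>l (k - 1)\<close> and above
    \<open>l k\<close>. Wherever the threshold lies, \<open>p + q \<ge> \<alpha>\<close>, and so the squared norm is at least \<open>\<alpha>\<^sup>2 * s / 2\<close>
    (\<open>gap_controls_off_diagonal_mass\<close>).

  \<^item> The \<open>k \<times> k\<close> matrix \<open>M\<close> of inner products \<open>v i \<bullet> v' j\<close> is a contraction. With \<open>Q\<close> its
    orthogonal polar factor, the trace of \<open>Q\<^sup>T M\<close> is the sum of the cosines of the principal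
    angles and dominates the sum of their squares, which is \<open>k - s\<close>; hence the squared
    Frobenius norm of \<open>V' - V Q\<close> is at most \<open>2 * s\<close> (\<open>frame_distance_after_alignment\<close>).
    Instead of a singular value decomposition, \<open>Q\<close> is obtained by maximising that trace over
    the compact orthogonal group (\<open>procrustes_contraction\<close>).

  Together, the Frobenius norm of \<open>V' - V Q\<close>, and a fortiori its spectral norm, is at most
  \<open>2 / \<alpha>\<close> times the Frobenius norm of \<open>A - A'\<close>.
\<close>


section \<open>Orthonormal families in coordinates\<close>

text \<open>
  Vectors and matrices are handled here as functions on indices, read only below explicit
  bounds. This makes linear combinations of vectors plain \<open>\<lambda>\<close>-terms without dimension side
  conditions.
\<close>

definition dot :: "nat \<Rightarrow> (nat \<Rightarrow> real) \<Rightarrow> (nat \<Rightarrow> real) \<Rightarrow> real" where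
  "dot n a b = (\<Sum>r<n. a r * b r)"

definition orthonormal :: "nat \<Rightarrow> nat \<Rightarrow> (nat \<Rightarrow> nat \<Rightarrow> real) \<Rightarrow> bool" where
  "orthonormal n k f \<longleftrightarrow> (\<forall>i<k. \<forall>j<k. dot n (f i) (f j) = (if i = j then 1 else 0))"

lemma dot_commute: "dot n a b = dot n b a"
  by (simp add: dot_def mult.commute)

lemma dot_self_nonneg: "0 \<le> dot n a a"
  by (simp add: dot_def sum_nonneg)

lemma dot_bilinear:
  "dot n (\<lambda>r. a r + b r) y = dot n a y + dot n b y"
  "dot n y (\<lambda>r. a r + b r) = dot n y a + dot n y b"
  "dot n (\<lambda>r. a r - b r) y = dot n a y - dot n b y"
  "dot n y (\<lambda>r. a r - b r) = dot n y a - dot n y b"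
  "dot n (\<lambda>r. c * a r) y = c * dot n a y"
  "dot n y (\<lambda>r. c * a r) = c * dot n y a"
  by (simp_all add: dot_def algebra_simps sum.distrib sum_subtractf sum_distrib_left)

lemma dot_sum_left: "dot n (\<lambda>r. \<Sum>i<k. f i r) y = (\<Sum>i<k. dot n (f i) y)"
  unfolding dot_def by (simp add: sum_distrib_right) (rule sum.swap)

lemma dot_sum_right: "dot n y (\<lambda>r. \<Sum>i<k. f i r) = (\<Sum>i<k. dot n y (f i))"
  by (simp add: dot_commute[of n y] dot_sum_left)

lemma dot_orthonormal_combination:
  assumes "orthonormal n k f" "i < k"
  shows "dot n (f i) (\<lambda>r. \<Sum>j<k. u j * f j r) = u i"
proof -
  have "dot n (f i) (\<lambda>r. \<Sum>j<k. u j * f j r) = (\<Sum>j<k. if i = j then u j else 0)"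
    using assms unfolding dot_sum_right dot_bilinear orthonormal_def
    by (intro sum.cong) auto
  with assms(2) show ?thesis by simp
qed

lemma norm_orthonormal_combination:
  assumes "orthonormal n k f"
  shows "dot n (\<lambda>r. \<Sum>i<k. u i * f i r) (\<lambda>r. \<Sum>i<k. u i * f i r) = (\<Sum>i<k. (u i)\<^sup>2)"
proof -
  have "dot n (\<lambda>r. \<Sum>i<k. u i * f i r) y = (\<Sum>i<k. u i * dot n (f i) y)" for y
    unfolding dot_sum_left dot_bilinear ..
  then show ?thesis
    using dot_orthonormal_combination[OF assms] by (simp add: power2_eq_square)
qed

text \<open>
  The squared distance of \<open>y\<close> to its projection \<open>p\<close> onto the span is nonnegative.
\<close>

lemma bessel_inequality:
  assumes "orthonormal n k f"
  shows "(\<Sum>i<k. (dot n (f i) y)\<^sup>2) \<le> dot n y y"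
proof -
  define p where "p = (\<lambda>r. \<Sum>i<k. dot n (f i) y * f i r)"
  have py: "dot n p y = (\<Sum>i<k. (dot n (f i) y)\<^sup>2)"
    unfolding p_def dot_sum_left dot_bilinear by (simp add: power2_eq_square)
  have "dot n p p = (\<Sum>i<k. (dot n (f i) y)\<^sup>2)"
    unfolding p_def by (rule norm_orthonormal_combination[OF assms])
  with py dot_self_nonneg[of n "\<lambda>r. y r - p r"] show ?thesis
    by (simp add: dot_bilinear dot_commute[of n y p])
qed

text \<open>
  A one-sided inverse of a square matrix is two-sided. This is how completeness of a family of
  \<open>n\<close> orthonormal vectors enters, and with it Parseval's identity.
\<close>

lemma orthonormal_transpose:
  assumes "orthonormal n n f"
  shows "orthonormal n n (\<lambda>r i. f i r)"
proof -
  define F where "F = Matrix.mat n n (\<lambda>(i, r). f i r)"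
  have F: "F \<in> carrier_mat n n" by (simp add: F_def)
  have "F * F\<^sup>T = 1\<^sub>m n"
    using assms by (intro eq_matI)
      (auto simp: F_def scalar_prod_def orthonormal_def dot_def lessThan_atLeast0)
  then have *: "F\<^sup>T * F = 1\<^sub>m n"
    using F mat_mult_left_right_inverse[of F n "F\<^sup>T"] by simp
  have "dot n (\<lambda>i. f i r) (\<lambda>i. f i s) = (if r = s then 1 else 0)" if "r < n" "s < n" for r s
  proof -
    have "dot n (\<lambda>i. f i r) (\<lambda>i. f i s) = (F\<^sup>T * F) $$ (r, s)"
      using that by (auto simp: F_def scalar_prod_def dot_def lessThan_atLeast0)
    then show ?thesis using that by (simp add: *)
  qed
  then show ?thesis by (simp add: orthonormal_def)
qed

lemma parseval_identity:
  assumes "orthonormal n n f"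
  shows "(\<Sum>i<n. (dot n (f i) y)\<^sup>2) = dot n y y"
proof -
  have "(\<lambda>i. dot n (f i) y) = (\<lambda>i. \<Sum>r<n. y r * f i r)"
    by (simp add: dot_def mult.commute)
  then have "(\<Sum>i<n. (dot n (f i) y)\<^sup>2)
      = dot n (\<lambda>i. \<Sum>r<n. y r * f i r) (\<lambda>i. \<Sum>r<n. y r * f i r)"
    by (simp add: dot_def power2_eq_square mult.commute)
  also have "\<dots> = (\<Sum>r<n. (y r)\<^sup>2)"
    by (rule norm_orthonormal_combination[OF orthonormal_transpose[OF assms]])
  finally show ?thesis by (simp add: dot_def power2_eq_square)
qed

lemma orthonormal_entry_bound:
  assumes "orthonormal n k f" "i < k" "r < n"
  shows "f i r \<in> {-1..1}"
proof -
  have "(f i r)\<^sup>2 \<le> (\<Sum>s<n. (f i s)\<^sup>2)"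
    using assms(3) by (intro member_le_sum) auto
  also have "\<dots> = 1"
    using assms(1,2) by (auto simp: orthonormal_def dot_def power2_eq_square)
  finally have "\<bar>f i r\<bar> \<le> 1" by (simp add: abs_square_le_1)
  then show ?thesis by auto
qed

section \<open>The orthogonal Procrustes problem for a contraction\<close>

text \<open>
  The orthogonal group is compact. To see this in the product topology on functions, the entries
  outside the \<open>k \<times> k\<close> block are set to \<open>0\<close>, which places the arrays in a product of compact
  sets.
\<close>

lemma exists_maximal_orthonormal_family:
  fixes m :: "nat \<Rightarrow> nat \<Rightarrow> real"
  obtains q where "orthonormal k k q"
    "\<And>p. orthonormal k k p \<Longrightarrow> (\<Sum>j<k. dot k (p j) (m j)) \<le> (\<Sum>j<k. dot k (q j) (m j))"
proof -
  define box :: "(nat \<times> nat \<Rightarrow> real) set" where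
    "box = (\<Pi>\<^sub>E z\<in>UNIV. if z \<in> {..<k} \<times> {..<k} then {-1..1} else {0})"
  define Orth where "Orth = {g. orthonormal k k (curry g)}"
  define F where "F = (\<lambda>g. \<Sum>j<k. dot k (curry g j) (m j))"
  have "compactin (product_topology (\<lambda>_. euclidean) UNIV) box"
    unfolding box_def by (subst compactin_PiE) auto
  then have "compact box" by (simp add: euclidean_product_topology)
  moreover have "closed Orth"
    unfolding Orth_def orthonormal_def dot_def curry_def
    by (intro closed_Collect_all closed_Collect_imp closed_Collect_eq open_Collect_const
        continuous_intros continuous_on_product_coordinates)
  ultimately have "compact (box \<inter> Orth)" by (rule compact_Int_closed)
  moreover have restrict: "(\<lambda>(i, r). if i < k \<and> r < k then p i r else 0) \<in> box \<inter> Orth"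
    and F_restrict: "F (\<lambda>(i, r). if i < k \<and> r < k then p i r else 0) = (\<Sum>j<k. dot k (p j) (m j))"
    if "orthonormal k k p" for p
    using that orthonormal_entry_bound[OF that]
    by (auto simp: box_def Orth_def F_def orthonormal_def dot_def)
  have "orthonormal k k (\<lambda>i r. if i = r then 1 else 0)"
    by (auto simp: orthonormal_def dot_def if_distrib[of "\<lambda>x. x * _"] cong: if_cong)
  from restrict[OF this] have "box \<inter> Orth \<noteq> {}" by blast
  moreover have "continuous_on (box \<inter> Orth) F"
    unfolding F_def dot_def curry_def
    by (intro continuous_intros continuous_on_subset[OF continuous_on_product_coordinates]) auto
  ultimately obtain g where g: "g \<in> box \<inter> Orth" and max: "\<And>h. h \<in> box \<inter> Orth \<Longrightarrow> F h \<le> F g"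
    by (metis continuous_attains_sup)
  show thesis
  proof
    show "orthonormal k k (curry g)" using g by (simp add: Orth_def)
    show "(\<Sum>j<k. dot k (p j) (m j)) \<le> (\<Sum>j<k. dot k (curry g j) (m j))"
      if "orthonormal k k p" for p
      using max[OF restrict[OF that]] F_restrict[OF that] by (simp add: F_def)
  qed
qed

text \<open>
  The two kinds of variation that are used to exploit maximality: a rotation in the plane of two
  members of the family, and the reflection of the whole family in the hyperplane orthogonal to
  a unit vector of the span.
\<close>

lemma rotation_orthonormal:
  assumes q: "orthonormal n k q" and ij: "i < k" "j < k" "i \<noteq> j" and cs: "c\<^sup>2 + s\<^sup>2 = 1"
  shows "orthonormal n k (q(i := \<lambda>r. c * q i r + s * q j r, j := \<lambda>r. c * q j r - s * q i r))"
proof -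
  have "c * c + s * s = 1" using cs by (simp add: power2_eq_square)
  then show ?thesis
    using q ij unfolding orthonormal_def
    by (auto simp: dot_bilinear algebra_simps)
qed

lemma reflection_orthonormal:
  assumes q: "orthonormal n k q" and u: "(\<Sum>l<k. (u l)\<^sup>2) = 1"
  shows "orthonormal n k (\<lambda>j r. q j r - 2 * u j * (\<Sum>l<k. u l * q l r))"
proof -
  define w where "w = (\<lambda>r. \<Sum>l<k. u l * q l r)"
  have ww: "dot n w w = 1"
    using norm_orthonormal_combination[OF q] u by (simp add: w_def)
  have qw: "dot n (q i) w = u i" "dot n w (q i) = u i" if "i < k" for i
    using dot_orthonormal_combination[OF q that] by (simp_all add: w_def dot_commute)
  have "dot n (\<lambda>r. q i r - (2 * u i) * w r) (\<lambda>r. q j r - (2 * u j) * w r)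
      = (if i = j then 1 else 0)" if "i < k" "j < k" for i j
    using q that unfolding dot_bilinear qw[OF that(1)] qw[OF that(2)] ww
    by (simp add: orthonormal_def)
  then show ?thesis unfolding orthonormal_def w_def by simp
qed

text \<open>
  Let \<open>S i j = q i \<bullet> m j\<close>. Rotating \<open>q i\<close> and \<open>q j\<close> by an angle with cosine \<open>c\<close> and sine \<open>s\<close>
  replaces \<open>a = S i i + S j j\<close> in the trace by \<open>c * a + s * b\<close>, where \<open>b = S j i - S i j\<close>. The
  maximum of this over all angles is \<open>sqrt (a\<^sup>2 + b\<^sup>2)\<close>, so maximality forces \<open>b = 0\<close>.
\<close>

lemma maximal_family_symmetric:
  assumes q: "orthonormal k k q"
    and max: "\<And>p. orthonormal k k p \<Longrightarrow> (\<Sum>j<k. dot k (p j) (m j)) \<le> (\<Sum>j<k. dot k (q j) (m j))"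
    and ij: "i < k" "j < k"
  shows "dot k (q i) (m j) = dot k (q j) (m i)"
proof (cases "i = j")
  case False
  define a where "a = dot k (q i) (m i) + dot k (q j) (m j)"
  define b where "b = dot k (q j) (m i) - dot k (q i) (m j)"
  have rot: "c * a + s * b \<le> a" if cs: "c\<^sup>2 + s\<^sup>2 = 1" for c s
  proof -
    define p where "p = q(i := \<lambda>r. c * q i r + s * q j r, j := \<lambda>r. c * q j r - s * q i r)"
    have split: "(\<Sum>l<k. f l) = f i + f j + (\<Sum>l\<in>{..<k} - {i, j}. f l)" for f :: "nat \<Rightarrow> real"
    proof -
      have "(\<Sum>l<k. f l) = sum f {i, j} + sum f ({..<k} - {i, j})"
        using ij by (subst add.commute, intro sum.subset_diff) auto
      with False show ?thesis by simp
    qed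
    have "(\<Sum>l<k. dot k (p l) (m l)) \<le> (\<Sum>l<k. dot k (q l) (m l))"
      unfolding p_def by (rule max[OF rotation_orthonormal[OF q ij False cs]])
    moreover have "(\<Sum>l\<in>{..<k} - {i, j}. dot k (p l) (m l)) = (\<Sum>l\<in>{..<k} - {i, j}. dot k (q l) (m l))"
      by (intro sum.cong) (auto simp: p_def)
    ultimately have "dot k (p i) (m i) + dot k (p j) (m j) \<le> a"
      unfolding split a_def by simp
    then show ?thesis
      using False by (simp add: p_def a_def b_def dot_bilinear algebra_simps)
  qed
  have "b = 0"
  proof (rule ccontr)
    assume "b \<noteq> 0"
    \<comment> \<open>The optimal angle is that of the vector \<open>(a, b)\<close>.\<close>
    define \<rho> where "\<rho> = sqrt (a\<^sup>2 + b\<^sup>2)"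
    have \<rho>2: "\<rho>\<^sup>2 = a\<^sup>2 + b\<^sup>2" by (simp add: \<rho>_def)
    have "\<rho> > 0" using \<open>b \<noteq> 0\<close> by (simp add: \<rho>_def sum_power2_gt_zero_iff)
    have "(a / \<rho>)\<^sup>2 + (b / \<rho>)\<^sup>2 = 1"
      using \<open>\<rho> > 0\<close> by (simp add: power_divide \<rho>2[symmetric] flip: add_divide_distrib)
    from rot[OF this] have "(a\<^sup>2 + b\<^sup>2) / \<rho> \<le> a"
      by (simp add: power2_eq_square add_divide_distrib)
    then have "\<rho> \<le> a"
      unfolding \<rho>2[symmetric] using \<open>\<rho> > 0\<close> by (simp add: power2_eq_square)
    then have "\<rho>\<^sup>2 \<le> a\<^sup>2" using \<open>\<rho> > 0\<close> by (intro power_mono) auto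
    with \<rho>2 \<open>b \<noteq> 0\<close> show False by simp
  qed
  then show ?thesis by (simp add: b_def)
qed simp

text \<open>
  Reflecting the family in the hyperplane orthogonal to the unit vector with coefficients \<open>u\<close>
  lowers the trace by twice the quadratic form of \<open>S\<close> at \<open>u\<close>; by maximality this is nonnegative.
  Vectors of other lengths follow by scaling.
\<close>

lemma maximal_family_psd:
  assumes q: "orthonormal k k q"
    and max: "\<And>p. orthonormal k k p \<Longrightarrow> (\<Sum>j<k. dot k (p j) (m j)) \<le> (\<Sum>j<k. dot k (q j) (m j))"
  shows "0 \<le> (\<Sum>j<k. u j * (\<Sum>l<k. u l * dot k (q l) (m j)))"
proof -
  have unit: "0 \<le> (\<Sum>j<k. u j * (\<Sum>l<k. u l * dot k (q l) (m j)))"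
    if u: "(\<Sum>l<k. (u l)\<^sup>2) = 1" for u
  proof -
    have "dot k (\<lambda>r. q j r - (2 * u j) * (\<Sum>l<k. u l * q l r)) (m j)
        = dot k (q j) (m j) - (2 * u j) * (\<Sum>l<k. u l * dot k (q l) (m j))" for j
      unfolding dot_bilinear dot_sum_left ..
    then show ?thesis
      using max[OF reflection_orthonormal[OF q u]]
      by (simp add: sum_subtractf mult.assoc flip: sum_distrib_left)
  qed
  define t where "t = (\<Sum>l<k. (u l)\<^sup>2)"
  show ?thesis
  proof (cases "t = 0")
    case True
    then have "u l = 0" if "l < k" for l
      using that by (simp add: t_def sum_nonneg_eq_0_iff)
    then show ?thesis by simp
  next
    case False
    then have "t > 0" by (simp add: t_def sum_nonneg order_less_le)
    have "(\<Sum>l<k. (u l / sqrt t)\<^sup>2) = t / t"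
      unfolding t_def using \<open>t > 0\<close>
      by (simp add: power_divide t_def flip: sum_divide_distrib)
    then have "0 \<le> (\<Sum>j<k. (u j / sqrt t) * (\<Sum>l<k. (u l / sqrt t) * dot k (q l) (m j)))"
      using False by (intro unit) simp
    also have "\<dots> = (\<Sum>j<k. u j * (\<Sum>l<k. u l * dot k (q l) (m j))) / t"
      using \<open>t > 0\<close> by (simp add: sum_divide_distrib sum_distrib_left)
    finally show ?thesis using \<open>t > 0\<close> by (simp add: zero_le_divide_iff)
  qed
qed

text \<open>
  For such \<open>S\<close> one has \<open>S\<^sup>2 \<le> S\<close>, and the trace of \<open>S\<^sup>2\<close> is the squared Frobenius norm. The
  inequality is proved at one unit vector \<open>e\<close> at a time, without diagonalising: with \<open>y = S e\<close>,
  expanding \<open>0 \<le> (e - y) \<bullet> S (e - y)\<close> gives \<open>2 * (y \<bullet> y) \<le> e \<bullet> S e + y \<bullet> S y\<close>, and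
  \<open>y \<bullet> S y \<le> y \<bullet> y\<close> because \<open>S\<close> is a contraction.
\<close>

lemma symmetric_psd_contraction_trace:
  fixes S :: "nat \<Rightarrow> nat \<Rightarrow> real"
  assumes sym: "\<And>i j. i < k \<Longrightarrow> j < k \<Longrightarrow> S i j = S j i"
    and psd: "\<And>u. 0 \<le> (\<Sum>j<k. u j * (\<Sum>l<k. u l * S l j))"
    and contr: "\<And>u. (\<Sum>i<k. (\<Sum>j<k. u j * S i j)\<^sup>2) \<le> (\<Sum>j<k. (u j)\<^sup>2)"
  shows "(\<Sum>i<k. \<Sum>j<k. (S i j)\<^sup>2) \<le> (\<Sum>j<k. S j j)"
proof -
  have col: "(\<Sum>i<k. (S i c)\<^sup>2) \<le> S c c" if c: "c < k" for c
  proof -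
    define y where "y i = S i c" for i
    define z where "z j = (\<Sum>l<k. y l * S l j)" for j
    define e where "e j = (if j = c then 1 else 0 :: real)" for j
    have z_alt: "z j = (\<Sum>l<k. y l * S j l)" if "j < k" for j
      unfolding z_def using sym that by (intro sum.cong) auto
    have zz: "(\<Sum>j<k. (z j)\<^sup>2) \<le> (\<Sum>j<k. (y j)\<^sup>2)"
      using contr[of y] z_alt by simp
    have yz: "(\<Sum>j<k. y j * z j) \<le> (\<Sum>j<k. (y j)\<^sup>2)"
    proof -
      have "0 \<le> (\<Sum>j<k. (y j - z j)\<^sup>2)" by (simp add: sum_nonneg)
      also have "\<dots> = (\<Sum>j<k. (y j)\<^sup>2) + (\<Sum>j<k. (z j)\<^sup>2) - 2 * (\<Sum>j<k. y j * z j)"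
        by (simp add: power2_diff sum_subtractf sum.distrib sum_distrib_left mult.assoc)
      finally show ?thesis using zz by simp
    qed
    have row: "(\<Sum>l<k. (e l - y l) * S l j) = y j - z j" if "j < k" for j
    proof -
      have "(\<Sum>l<k. e l * S l j) = (\<Sum>l<k. if l = c then S l j else 0)"
        by (intro sum.cong) (auto simp: e_def)
      also have "\<dots> = y j" using c that sym by (simp add: y_def)
      finally show ?thesis by (simp add: left_diff_distrib sum_subtractf z_def)
    qed
    have zc: "z c = (\<Sum>l<k. (y l)\<^sup>2)"
      by (simp add: z_def y_def power2_eq_square)
    have e_sum: "(\<Sum>j<k. e j * f j) = f c" for f
    proof -
      have "(\<Sum>j<k. e j * f j) = (\<Sum>j<k. if j = c then f j else 0)"
        by (intro sum.cong) (auto simp: e_def)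
      with c show ?thesis by simp
    qed
    have "0 \<le> (\<Sum>j<k. (e j - y j) * (y j - z j))"
      using psd[of "\<lambda>j. e j - y j"] row by simp
    also have "\<dots> = (y c - z c) - (\<Sum>j<k. (y j)\<^sup>2) + (\<Sum>j<k. y j * z j)"
      by (simp add: left_diff_distrib sum_subtractf e_sum right_diff_distrib power2_eq_square)
    also have "\<dots> \<le> S c c - (\<Sum>j<k. (y j)\<^sup>2)"
      using yz zc by (simp add: y_def)
    finally show ?thesis by (simp add: y_def)
  qed
  have "(\<Sum>i<k. \<Sum>j<k. (S i j)\<^sup>2) = (\<Sum>j<k. \<Sum>i<k. (S i j)\<^sup>2)" by (rule sum.swap)
  also have "\<dots> \<le> (\<Sum>j<k. S j j)" using col by (intro sum_mono) auto
  finally show ?thesis .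
qed

text \<open>
  Passing from \<open>m\<close> to the matrix \<open>S i j = q i \<bullet> m j\<close> is multiplication by an orthogonal matrix,
  so it preserves the contraction property and the Frobenius norm; for the maximal \<open>q\<close>
  the matrix \<open>S\<close> is moreover symmetric and positive semidefinite.
\<close>

lemma procrustes_contraction:
  fixes m :: "nat \<Rightarrow> nat \<Rightarrow> real"
  assumes contr: "\<And>u. (\<Sum>r<k. (\<Sum>j<k. u j * m j r)\<^sup>2) \<le> (\<Sum>j<k. (u j)\<^sup>2)"
  obtains q where "orthonormal k k q"
    "(\<Sum>j<k. \<Sum>r<k. (m j r)\<^sup>2) \<le> (\<Sum>j<k. dot k (q j) (m j))"
proof -
  obtain q where q: "orthonormal k k q"
    and max: "\<And>p. orthonormal k k p \<Longrightarrow> (\<Sum>j<k. dot k (p j) (m j)) \<le> (\<Sum>j<k. dot k (q j) (m j))"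
    using exists_maximal_orthonormal_family by blast
  have "(\<Sum>i<k. \<Sum>j<k. (dot k (q i) (m j))\<^sup>2) \<le> (\<Sum>j<k. dot k (q j) (m j))"
  proof (rule symmetric_psd_contraction_trace)
    show "(\<Sum>i<k. (\<Sum>j<k. u j * dot k (q i) (m j))\<^sup>2) \<le> (\<Sum>j<k. (u j)\<^sup>2)" for u
    proof -
      have "(\<Sum>i<k. (\<Sum>j<k. u j * dot k (q i) (m j))\<^sup>2)
          = (\<Sum>i<k. (dot k (q i) (\<lambda>r. \<Sum>j<k. u j * m j r))\<^sup>2)"
        by (simp add: dot_sum_right dot_bilinear)
      also have "\<dots> \<le> (\<Sum>r<k. (\<Sum>j<k. u j * m j r)\<^sup>2)"
        using bessel_inequality[OF q] by (simp add: dot_def power2_eq_square)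
      finally show ?thesis using contr[of u] by simp
    qed
  qed (use maximal_family_symmetric[OF q max] maximal_family_psd[OF q max] in auto)
  moreover have "(\<Sum>j<k. \<Sum>r<k. (m j r)\<^sup>2) = (\<Sum>i<k. \<Sum>j<k. (dot k (q i) (m j))\<^sup>2)"
    by (subst (2) sum.swap) (simp add: parseval_identity[OF q], simp add: dot_def power2_eq_square)
  ultimately show thesis using q that by auto
qed


text \<open>
  Each column contributes \<open>2 - 2 * (q j \<bullet> m j)\<close>, being the squared distance of two unit vectors,
  where \<open>m\<close> holds the mutual inner products of the two frames. These form a contraction by
  Bessel's inequality.
\<close>

lemma frame_distance_after_alignment:
  assumes f: "orthonormal n k f" and g: "orthonormal n k g"
  obtains q where "orthonormal k k q"
    "(\<Sum>j<k. \<Sum>r<n. (g j r - (\<Sum>i<k. q j i * f i r))\<^sup>2)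
      \<le> 2 * (real k - (\<Sum>i<k. \<Sum>j<k. (dot n (f i) (g j))\<^sup>2))"
proof -
  define m where "m j i = dot n (f i) (g j)" for j i
  have "(\<Sum>r<k. (\<Sum>j<k. u j * m j r)\<^sup>2) \<le> (\<Sum>j<k. (u j)\<^sup>2)" for u
  proof -
    have "(\<Sum>j<k. u j * m j r) = dot n (f r) (\<lambda>s. \<Sum>j<k. u j * g j s)" for r
      unfolding dot_sum_right dot_bilinear m_def ..
    then show ?thesis
      using bessel_inequality[OF f, of "\<lambda>s. \<Sum>j<k. u j * g j s"] norm_orthonormal_combination[OF g, of u]
      by simp
  qed
  from procrustes_contraction[OF this]
  obtain q where q: "orthonormal k k q"
    and le: "(\<Sum>j<k. \<Sum>i<k. (m j i)\<^sup>2) \<le> (\<Sum>j<k. dot k (q j) (m j))"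
    by blast
  have "(\<Sum>r<n. (g j r - (\<Sum>i<k. q j i * f i r))\<^sup>2) = 2 - 2 * dot k (q j) (m j)"
    if j: "j < k" for j
  proof -
    define w where "w = (\<lambda>r. \<Sum>i<k. q j i * f i r)"
    have "dot n w w = (\<Sum>i<k. (q j i)\<^sup>2)"
      unfolding w_def by (rule norm_orthonormal_combination[OF f])
    also have "\<dots> = 1" using q j by (auto simp: orthonormal_def dot_def power2_eq_square)
    finally have ww: "dot n w w = 1" .
    have gg: "dot n (g j) (g j) = 1" using g j by (simp add: orthonormal_def)
    have wg: "dot n w (g j) = dot k (q j) (m j)"
      unfolding w_def dot_sum_left dot_bilinear by (simp add: dot_def[of k] m_def)
    have "(\<Sum>r<n. (g j r - w r)\<^sup>2) = dot n (\<lambda>r. g j r - w r) (\<lambda>r. g j r - w r)"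
      by (simp add: dot_def power2_eq_square)
    also have "\<dots> = 2 - 2 * dot n w (g j)"
      by (simp add: dot_bilinear ww gg dot_commute[of n "g j" w])
    finally show ?thesis unfolding wg unfolding w_def .
  qed
  then have "(\<Sum>j<k. \<Sum>r<n. (g j r - (\<Sum>i<k. q j i * f i r))\<^sup>2)
      = 2 * (real k - (\<Sum>j<k. dot k (q j) (m j)))"
    by (simp add: sum_subtractf sum_distrib_left)
  also have "\<dots> \<le> 2 * (real k - (\<Sum>i<k. \<Sum>j<k. (dot n (f i) (g j))\<^sup>2))"
    using le by (subst sum.swap) (simp add: m_def)
  finally show thesis using q that by blast
qed

section \<open>Spectral gap and mutual overlaps of two eigenbases\<close>

lemma frobenius_orthonormal_invariance:
  assumes f: "orthonormal n n f" and g: "orthonormal n n g"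
  shows "(\<Sum>i<n. \<Sum>j<n. (dot n (f i) (\<lambda>r. dot n (e r) (g j)))\<^sup>2) = (\<Sum>r<n. \<Sum>s<n. (e r s)\<^sup>2)"
proof -
  have dot_self: "dot n y y = (\<Sum>r<n. (y r)\<^sup>2)" for y
    by (simp add: dot_def power2_eq_square)
  have "(\<Sum>i<n. \<Sum>j<n. (dot n (f i) (\<lambda>r. dot n (e r) (g j)))\<^sup>2)
      = (\<Sum>j<n. dot n (\<lambda>r. dot n (e r) (g j)) (\<lambda>r. dot n (e r) (g j)))"
    by (subst sum.swap) (simp add: parseval_identity[OF f])
  also have "\<dots> = (\<Sum>r<n. \<Sum>j<n. (dot n (g j) (e r))\<^sup>2)"
    unfolding dot_self by (subst sum.swap) (simp add: dot_commute)
  also have "\<dots> = (\<Sum>r<n. \<Sum>s<n. (e r s)\<^sup>2)"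
    unfolding parseval_identity[OF g] dot_self ..
  finally show ?thesis .
qed

text \<open>
  Symmetry of \<open>a\<close> lets it act on the left factor: \<open>f i \<bullet> a (g j) = l i * (f i \<bullet> g j)\<close>. For \<open>b\<close>
  it acts on its own eigenvector \<open>g j\<close>.
\<close>

lemma eigenbasis_perturbation_identity:
  fixes a b :: "nat \<Rightarrow> nat \<Rightarrow> real"
  assumes f: "orthonormal n n f" and g: "orthonormal n n g"
    and sym: "\<And>r s. r < n \<Longrightarrow> s < n \<Longrightarrow> a r s = a s r"
    and eig_a: "\<And>i r. i < n \<Longrightarrow> r < n \<Longrightarrow> dot n (a r) (f i) = l i * f i r"
    and eig_b: "\<And>j r. j < n \<Longrightarrow> r < n \<Longrightarrow> dot n (b r) (g j) = l' j * g j r"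
  shows "(\<Sum>r<n. \<Sum>s<n. (a r s - b r s)\<^sup>2) = (\<Sum>i<n. \<Sum>j<n. (l i - l' j)\<^sup>2 * (dot n (f i) (g j))\<^sup>2)"
proof -
  have "dot n (f i) (\<lambda>r. dot n (\<lambda>s. a r s - b r s) (g j)) = (l i - l' j) * dot n (f i) (g j)"
    if "i < n" "j < n" for i j
  proof -
    have "dot n (f i) (\<lambda>r. dot n (a r) (g j)) = (\<Sum>s<n. dot n (\<lambda>r. a r s) (f i) * g j s)"
      unfolding dot_def by (simp add: sum_distrib_left sum_distrib_right) (subst sum.swap, simp add: mult_ac)
    also have "\<dots> = (\<Sum>s<n. dot n (a s) (f i) * g j s)"
      using sym by (simp add: dot_def)
    also have "\<dots> = l i * dot n (f i) (g j)"
      using eig_a \<open>i < n\<close> by (simp add: dot_def[of n "f i"] sum_distrib_left mult.assoc)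
    finally have 1: "dot n (f i) (\<lambda>r. dot n (a r) (g j)) = l i * dot n (f i) (g j)" .
    have 2: "dot n (f i) (\<lambda>r. dot n (b r) (g j)) = l' j * dot n (f i) (g j)"
      using eig_b \<open>j < n\<close> by (simp add: dot_def[of n "f i"] sum_distrib_left mult_ac)
    show ?thesis by (simp add: dot_bilinear 1 2 left_diff_distrib)
  qed
  then show ?thesis
    unfolding frobenius_orthonormal_invariance[OF f g, of "\<lambda>r s. a r s - b r s", symmetric]
    by (simp add: power_mult_distrib)
qed

text \<open>
  The first \<open>k\<close> rows and the first \<open>k\<close> columns both have total mass \<open>k\<close>, and they share the
  leading \<open>k \<times> k\<close> block.
\<close>

lemma off_diagonal_mass:
  fixes c :: "nat \<Rightarrow> nat \<Rightarrow> real"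
  assumes row: "\<And>i. i < n \<Longrightarrow> (\<Sum>j<n. c i j) = 1" and col: "\<And>j. j < n \<Longrightarrow> (\<Sum>i<n. c i j) = 1"
    and "k \<le> n"
  shows "(\<Sum>i<k. \<Sum>j=k..<n. c i j) = real k - (\<Sum>i<k. \<Sum>j<k. c i j)"
    and "(\<Sum>i=k..<n. \<Sum>j<k. c i j) = real k - (\<Sum>i<k. \<Sum>j<k. c i j)"
proof -
  have split: "sum h {..<n} = sum h {..<k} + sum h {k..<n}" for h :: "nat \<Rightarrow> real"
    using sum.atLeastLessThan_concat[of 0 k n h] \<open>k \<le> n\<close> by (simp add: lessThan_atLeast0)
  have "(\<Sum>j=k..<n. c i j) = 1 - (\<Sum>j<k. c i j)" if "i < k" for i
    using row[of i] split[of "c i"] that \<open>k \<le> n\<close> by simp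
  then show "(\<Sum>i<k. \<Sum>j=k..<n. c i j) = real k - (\<Sum>i<k. \<Sum>j<k. c i j)"
    by (simp add: sum_subtractf)
  have "(\<Sum>i=k..<n. c i j) = 1 - (\<Sum>i<k. c i j)" if "j < k" for j
    using col[of j] split[of "\<lambda>i. c i j"] that \<open>k \<le> n\<close> by simp
  then have "(\<Sum>j<k. \<Sum>i=k..<n. c i j) = real k - (\<Sum>j<k. \<Sum>i<k. c i j)"
    by (simp add: sum_subtractf)
  moreover have "(\<Sum>i=k..<n. \<Sum>j<k. c i j) = (\<Sum>j<k. \<Sum>i=k..<n. c i j)"
    by (rule sum.swap)
  moreover have "(\<Sum>j<k. \<Sum>i<k. c i j) = (\<Sum>i<k. \<Sum>j<k. c i j)"
    by (rule sum.swap)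
  ultimately show "(\<Sum>i=k..<n. \<Sum>j<k. c i j) = real k - (\<Sum>i<k. \<Sum>j<k. c i j)"
    by simp
qed

text \<open>
  The value \<open>l' k\<close> separates the first \<open>k\<close> numbers \<open>l' j\<close> from the others. If it lies below
  \<open>l (k - 1)\<close> by \<open>p\<close>, all differences \<open>l i - l' j\<close> with \<open>i < k \<le> j\<close> are at least \<open>p\<close>; if it lies
  above \<open>l k\<close> by \<open>q\<close>, all those with \<open>j < k \<le> i\<close> are at least \<open>q\<close> in absolute value. The gap
  forces \<open>p + q \<ge> \<alpha>\<close>, and \<open>p\<^sup>2 + q\<^sup>2 \<ge> (p + q)\<^sup>2 / 2\<close>.
\<close>

lemma gap_controls_off_diagonal_mass:
  fixes c :: "nat \<Rightarrow> nat \<Rightarrow> real" and l l' :: "nat \<Rightarrow> real"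
  assumes row: "\<And>i. i < n \<Longrightarrow> (\<Sum>j<n. c i j) = 1" and col: "\<And>j. j < n \<Longrightarrow> (\<Sum>i<n. c i j) = 1"
    and nonneg: "\<And>i j. 0 \<le> c i j"
    and k: "1 \<le> k" "k < n"
    and l: "\<And>i j. i \<le> j \<Longrightarrow> j < n \<Longrightarrow> l j \<le> l i"
    and l': "\<And>i j. i \<le> j \<Longrightarrow> j < n \<Longrightarrow> l' j \<le> l' i"
    and gap: "\<alpha> \<le> l (k - 1) - l k" and "0 \<le> \<alpha>"
  shows "\<alpha>\<^sup>2 * (real k - (\<Sum>i<k. \<Sum>j<k. c i j)) \<le> 2 * (\<Sum>i<n. \<Sum>j<n. (l i - l' j)\<^sup>2 * c i j)"
proof -
  define p where "p = max 0 (l (k - 1) - l' k)"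
  define q where "q = max 0 (l' k - l k)"
  define s where "s = real k - (\<Sum>i<k. \<Sum>j<k. c i j)"
  have mass: "(\<Sum>i<k. \<Sum>j=k..<n. c i j) = s" "(\<Sum>i=k..<n. \<Sum>j<k. c i j) = s"
    unfolding s_def using k by (intro off_diagonal_mass[OF row col]; simp)+
  have "0 \<le> s" unfolding mass(1)[symmetric] by (simp add: sum_nonneg nonneg)
  have upper: "p\<^sup>2 * c i j \<le> (l i - l' j)\<^sup>2 * c i j" if "i < k" "j \<in> {k..<n}" for i j
  proof -
    have "l (k - 1) \<le> l i" "l' j \<le> l' k" using that k by (auto intro: l l')
    then have "\<bar>p\<bar> \<le> \<bar>l i - l' j\<bar>" unfolding p_def by auto
    then show ?thesis by (intro mult_right_mono nonneg) (simp add: abs_le_square_iff)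
  qed
  have lower: "q\<^sup>2 * c i j \<le> (l i - l' j)\<^sup>2 * c i j" if "i \<in> {k..<n}" "j < k" for i j
  proof -
    have "l i \<le> l k" "l' k \<le> l' j" using that k by (auto intro: l l')
    then have "\<bar>q\<bar> \<le> \<bar>l i - l' j\<bar>" unfolding q_def by auto
    then show ?thesis by (intro mult_right_mono nonneg) (simp add: abs_le_square_iff)
  qed
  have "\<alpha>\<^sup>2 \<le> (p + q)\<^sup>2"
    using gap \<open>0 \<le> \<alpha>\<close> by (intro power_mono) (auto simp: p_def q_def)
  also have "\<dots> \<le> 2 * (p\<^sup>2 + q\<^sup>2)"
    using zero_le_power2[of "p - q"] by (simp add: power2_sum power2_diff)
  finally have "\<alpha>\<^sup>2 * s \<le> 2 * (p\<^sup>2 + q\<^sup>2) * s"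
    using \<open>0 \<le> s\<close> by (rule mult_right_mono)
  also have "\<dots> = 2 * ((\<Sum>i<k. \<Sum>j=k..<n. p\<^sup>2 * c i j) + (\<Sum>i=k..<n. \<Sum>j<k. q\<^sup>2 * c i j))"
    by (simp add: mass distrib_left distrib_right mult.assoc flip: sum_distrib_left)
  also have "\<dots> \<le> 2 * ((\<Sum>i<k. \<Sum>j=k..<n. (l i - l' j)\<^sup>2 * c i j)
                    + (\<Sum>i=k..<n. \<Sum>j<k. (l i - l' j)\<^sup>2 * c i j))"
    using upper lower by (intro mult_left_mono add_mono sum_mono) auto
  also have "\<dots> \<le> 2 * (\<Sum>i<n. \<Sum>j<n. (l i - l' j)\<^sup>2 * c i j)"
  proof -
    let ?w = "\<lambda>i j. (l i - l' j)\<^sup>2 * c i j"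
    have "(\<Sum>i<n. \<Sum>j<n. ?w i j) = (\<Sum>i<k. \<Sum>j<n. ?w i j) + (\<Sum>i=k..<n. \<Sum>j<n. ?w i j)"
      using sum.atLeastLessThan_concat[of 0 k n "\<lambda>i. \<Sum>j<n. ?w i j"] k by (simp add: lessThan_atLeast0)
    moreover have "(\<Sum>i<k. \<Sum>j=k..<n. ?w i j) \<le> (\<Sum>i<k. \<Sum>j<n. ?w i j)"
      by (intro sum_mono sum_mono2) (auto simp: nonneg)
    moreover have "(\<Sum>i=k..<n. \<Sum>j<k. ?w i j) \<le> (\<Sum>i=k..<n. \<Sum>j<n. ?w i j)"
      using k by (intro sum_mono sum_mono2) (auto simp: nonneg)
    ultimately show ?thesis by simp
  qed
  finally show ?thesis by (simp add: s_def)
qed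

section \<open>Matrix norms and eigenvector matrices\<close>

lemma frobenius_norm_square:
  "(frobenius_norm M)\<^sup>2 = (\<Sum>i<dim_row M. \<Sum>j<dim_col M. (M $$ (i, j))\<^sup>2)"
  by (simp add: frobenius_norm_def L2_set_def sum_nonneg sum.cartesian_product)

lemma spectral_norm_le_frobenius_norm: "spectral_norm M \<le> frobenius_norm M"
  unfolding spectral_norm_def
proof (rule cSUP_least)
  have "l2_vec_norm (0\<^sub>v (dim_col M)) \<le> 1" by (simp add: l2_vec_norm_def L2_set_def)
  then show "{u \<in> carrier_vec (dim_col M). l2_vec_norm u \<le> 1} \<noteq> {}"
    using zero_carrier_vec by blast
next
  fix u assume "u \<in> {u \<in> carrier_vec (dim_col M). l2_vec_norm u \<le> 1}"
  then have u: "dim_vec u = dim_col M" and "l2_vec_norm u \<le> 1" by auto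
  then have u1: "(\<Sum>j<dim_col M. (u $ j)\<^sup>2) \<le> 1"
    by (simp add: l2_vec_norm_def L2_set_def real_sqrt_le_1_iff)
  have "((M *\<^sub>v u) $ i)\<^sup>2 \<le> (\<Sum>j<dim_col M. (M $$ (i, j))\<^sup>2)" if i: "i < dim_row M" for i
  proof -
    have "(M *\<^sub>v u) $ i = (\<Sum>j<dim_col M. M $$ (i, j) * u $ j)"
      using i u by (simp add: scalar_prod_def lessThan_atLeast0)
    then have "((M *\<^sub>v u) $ i)\<^sup>2 \<le> (\<Sum>j<dim_col M. (M $$ (i, j))\<^sup>2) * (\<Sum>j<dim_col M. (u $ j)\<^sup>2)"
      by (simp add: Cauchy_Schwarz_ineq_sum)
    also have "\<dots> \<le> (\<Sum>j<dim_col M. (M $$ (i, j))\<^sup>2)"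
      using mult_left_mono[OF u1] by (simp add: sum_nonneg)
    finally show ?thesis .
  qed
  then have "(\<Sum>i<dim_row M. ((M *\<^sub>v u) $ i)\<^sup>2) \<le> (frobenius_norm M)\<^sup>2"
    unfolding frobenius_norm_square by (intro sum_mono) auto
  then have "sqrt (\<Sum>i<dim_row M. ((M *\<^sub>v u) $ i)\<^sup>2) \<le> frobenius_norm M"
    by (intro real_le_lsqrt) (auto simp: frobenius_norm_def)
  then show "l2_vec_norm (M *\<^sub>v u) \<le> frobenius_norm M"
    by (simp add: l2_vec_norm_def L2_set_def)
qed

lemma unitary_mat_of_orthonormal:
  assumes "orthonormal k k q"
  shows "unitary_mat k (Matrix.mat k k (\<lambda>(i, j). q j i))"
proof -
  define Q where "Q = Matrix.mat k k (\<lambda>(i, j). q j i)"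
  have Q: "Q \<in> carrier_mat k k" by (simp add: Q_def)
  have adj: "mat_adjoint Q = Q\<^sup>T"
    by (rule eq_matI) (auto simp: mat_adjoint_def mat_of_rows_def)
  have "Q\<^sup>T * Q = 1\<^sub>m k"
    using assms by (intro eq_matI)
      (auto simp: Q_def scalar_prod_def orthonormal_def dot_def lessThan_atLeast0)
  moreover from this have "Q * Q\<^sup>T = 1\<^sub>m k"
    using Q mat_mult_left_right_inverse[of "Q\<^sup>T" k Q] by simp
  ultimately show ?thesis
    using Q adj unfolding Q_def[symmetric] unitary_mat_def by simp
qed

lemma eigenbasis_coordinates:
  assumes A: "A \<in> carrier_mat n n" and basis: "ordered_orthonormal_eigenbasis A l v"
  shows "orthonormal n n (\<lambda>i r. v i $ r)"
    and "\<And>i r. i < n \<Longrightarrow> r < n \<Longrightarrow> dot n (\<lambda>s. A $$ (r, s)) (\<lambda>s. v i $ s) = l i * v i $ r"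
    and "\<And>i j. i \<le> j \<Longrightarrow> j < n \<Longrightarrow> l j \<le> l i"
proof -
  have v: "dim_vec (v i) = n" and eig: "A *\<^sub>v v i = l i \<cdot>\<^sub>v v i" if "i < n" for i
    using basis A that by (auto simp: ordered_orthonormal_eigenbasis_def eigenvector_def)
  show "orthonormal n n (\<lambda>i r. v i $ r)"
    using basis A v
    by (auto simp: ordered_orthonormal_eigenbasis_def orthonormal_def dot_def scalar_prod_def lessThan_atLeast0)
  show "dot n (\<lambda>s. A $$ (r, s)) (\<lambda>s. v i $ s) = l i * v i $ r" if "i < n" "r < n" for i r
  proof -
    have "dot n (\<lambda>s. A $$ (r, s)) (\<lambda>s. v i $ s) = (A *\<^sub>v v i) $ r"
      using A v that by (simp add: dot_def scalar_prod_def lessThan_atLeast0)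
    then show ?thesis using eig v that by simp
  qed
  show "\<And>i j. i \<le> j \<Longrightarrow> j < n \<Longrightarrow> l j \<le> l i"
    using basis A by (auto simp: ordered_orthonormal_eigenbasis_def)
qed

section \<open>Perturbation of the top eigenspace\<close>

text \<open>
  With \<open>s\<close> the off-diagonal mass of the squared overlaps, alignment bounds the squared norm on
  the left by \<open>2 * s\<close>, while the gap bounds \<open>\<alpha>\<^sup>2 * s\<close> by twice the squared norm on the right. The
  mass cancels, leaving the factor \<open>2\<^sup>2 / \<alpha>\<^sup>2\<close> between the squares.
\<close>

theorem davis_kahan_aligned:
  fixes A A' :: "real mat"
  assumes A: "A \<in> carrier_mat n n" and A': "A' \<in> carrier_mat n n"
    and sym: "\<And>i j. i < n \<Longrightarrow> j < n \<Longrightarrow> A $$ (i, j) = A $$ (j, i)"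
    and basis: "ordered_orthonormal_eigenbasis A l v"
    and basis': "ordered_orthonormal_eigenbasis A' l' v'"
    and k: "1 \<le> k" "k < n" and "0 < \<alpha>" and gap: "\<alpha> \<le> l (k - 1) - l k"
  obtains Q where "unitary_mat k Q"
    "frobenius_norm (top_eigvec_mat n k v' - top_eigvec_mat n k v * Q) \<le> 2 / \<alpha> * frobenius_norm (A - A')"
proof -
  define f where "f = (\<lambda>i r. v i $ r)"
  define g where "g = (\<lambda>i r. v' i $ r)"
  note f = eigenbasis_coordinates[OF A basis, folded f_def]
  note g = eigenbasis_coordinates[OF A' basis', folded g_def]
  have f': "orthonormal n k f" and g': "orthonormal n k g"
    using f(1) g(1) k by (auto simp: orthonormal_def)
  obtain q where q: "orthonormal k k q"
    and align: "(\<Sum>j<k. \<Sum>r<n. (g j r - (\<Sum>i<k. q j i * f i r))\<^sup>2)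
      \<le> 2 * (real k - (\<Sum>i<k. \<Sum>j<k. (dot n (f i) (g j))\<^sup>2))"
    using frame_distance_after_alignment[OF f' g'] .
  define Q where "Q = Matrix.mat k k (\<lambda>(i, j). q j i)"
  define R where "R = top_eigvec_mat n k v' - top_eigvec_mat n k v * Q"
  have "(frobenius_norm (A - A'))\<^sup>2 = (\<Sum>r<n. \<Sum>s<n. (A $$ (r, s) - A' $$ (r, s))\<^sup>2)"
    using A A' by (simp add: frobenius_norm_square)
  also have "\<dots> = (\<Sum>i<n. \<Sum>j<n. (l i - l' j)\<^sup>2 * (dot n (f i) (g j))\<^sup>2)"
    by (rule eigenbasis_perturbation_identity[OF f(1) g(1)]) (use sym f(2) g(2) in \<open>auto simp: f_def g_def\<close>)
  finally have E: "(frobenius_norm (A - A'))\<^sup>2 = (\<Sum>i<n. \<Sum>j<n. (l i - l' j)\<^sup>2 * (dot n (f i) (g j))\<^sup>2)" .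
  have mass: "\<alpha>\<^sup>2 * (real k - (\<Sum>i<k. \<Sum>j<k. (dot n (f i) (g j))\<^sup>2)) \<le> 2 * (frobenius_norm (A - A'))\<^sup>2"
    unfolding E
  proof (rule gap_controls_off_diagonal_mass)
    show "(\<Sum>j<n. (dot n (f i) (g j))\<^sup>2) = 1" if "i < n" for i
      using parseval_identity[OF g(1), of "f i"] f(1) that by (simp add: dot_commute orthonormal_def)
    show "(\<Sum>i<n. (dot n (f i) (g j))\<^sup>2) = 1" if "j < n" for j
      using parseval_identity[OF f(1), of "g j"] g(1) that by (simp add: orthonormal_def)
  qed (use k f(3) g(3) gap \<open>0 < \<alpha>\<close> in auto)
  have "R $$ (r, j) = g j r - (\<Sum>i<k. q j i * f i r)" if "r < n" "j < k" for r j
    using that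
    by (simp add: R_def Q_def top_eigvec_mat_def mat_of_cols_def f_def g_def scalar_prod_def
        lessThan_atLeast0 mult.commute)
  moreover have "dim_row R = n" "dim_col R = k"
    by (simp_all add: R_def Q_def top_eigvec_mat_def)
  ultimately have "(frobenius_norm R)\<^sup>2 = (\<Sum>j<k. \<Sum>r<n. (g j r - (\<Sum>i<k. q j i * f i r))\<^sup>2)"
    unfolding frobenius_norm_square by (subst sum.swap) simp
  with align mass have "\<alpha>\<^sup>2 * (frobenius_norm R)\<^sup>2 \<le> 2\<^sup>2 * (frobenius_norm (A - A'))\<^sup>2"
    using mult_left_mono[OF align, of "\<alpha>\<^sup>2"] by (simp add: algebra_simps)
  then have "(\<alpha> * frobenius_norm R)\<^sup>2 \<le> (2 * frobenius_norm (A - A'))\<^sup>2"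
    by (simp add: power_mult_distrib)
  then have "\<alpha> * frobenius_norm R \<le> 2 * frobenius_norm (A - A')"
    by (rule power2_le_imp_le) (simp add: frobenius_norm_def)
  then have "frobenius_norm R \<le> 2 / \<alpha> * frobenius_norm (A - A')"
    using \<open>0 < \<alpha>\<close> by (simp add: field_simps)
  moreover have "unitary_mat k Q"
    unfolding Q_def by (rule unitary_mat_of_orthonormal[OF q])
  ultimately show thesis using that by (simp add: R_def)
qed

lemma affinity_mat_symmetric:
  "affinity_mat \<sigma> N x \<in> carrier_mat N N"
  "i < N \<Longrightarrow> j < N \<Longrightarrow> affinity_mat \<sigma> N x $$ (i, j) = affinity_mat \<sigma> N x $$ (j, i)"
proof -
  define W where "W = gauss_weight_mat \<sigma> N x"
  define d where "d i = (degree_mat W $$ (i, i)) powr (- (1 / 2))" for i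
  have W: "W \<in> carrier_mat N N" by (simp add: W_def gauss_weight_mat_def)
  have R: "diag_inv_sqrt (degree_mat W) = mat_diag N d"
  proof -
    have "dim_row (degree_mat W) = N" using W by (simp add: degree_mat_def mat_diag_def)
    then show ?thesis by (simp add: diag_inv_sqrt_def d_def[abs_def])
  qed
  have A: "affinity_mat \<sigma> N x = mat_diag N d * W * mat_diag N d"
    by (simp add: affinity_mat_def Let_def W_def[symmetric] R)
  have A': "affinity_mat \<sigma> N x = Matrix.mat N N (\<lambda>(i, j). d i * W $$ (i, j) * d j)"
    unfolding A mat_diag_mult_left[OF W] by (subst mat_diag_mult_right) (auto intro!: eq_matI)
  show "affinity_mat \<sigma> N x \<in> carrier_mat N N" by (simp add: A')
  show "affinity_mat \<sigma> N x $$ (i, j) = affinity_mat \<sigma> N x $$ (j, i)" if "i < N" "j < N"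
    using that by (simp add: A' W_def gauss_weight_mat_def norm_minus_commute)
qed

theorem theorem5:
  fixes \<sigma> \<alpha> :: real
    and N k :: nat
    and x :: "nat \<Rightarrow> 'a::euclidean_space"
    and x' :: "nat \<Rightarrow> 'b::euclidean_space"
    and l l' :: "nat \<Rightarrow> real"
    and v v' :: "nat \<Rightarrow> real vec"
    and A A' V V' :: "real mat"
  assumes "\<sigma> > 0"
    and "1 \<le> k" and "k < N"
    and "\<alpha> > 0"
    and "A = affinity_mat \<sigma> N x"
    and "A' = affinity_mat \<sigma> N x'"
    and "ordered_orthonormal_eigenbasis A l v"
    and "ordered_orthonormal_eigenbasis A' l' v'"
    and "V = top_eigvec_mat N k v"
    and "V' = top_eigvec_mat N k v'"
    and "l (k - 1) - l k \<ge> \<alpha>"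
    and "l (k - 1) \<ge> \<alpha>"
  shows "\<exists>Q :: real mat. unitary_mat k Q \<and>
           spectral_norm (V' - V * Q) \<le> (1 + sqrt 2) * (1 / \<alpha>) * frobenius_norm (A - A')"
proof -
  obtain Q where Q: "unitary_mat k Q"
    and bound: "frobenius_norm (V' - V * Q) \<le> 2 / \<alpha> * frobenius_norm (A - A')"
    unfolding \<open>V = _\<close> \<open>V' = _\<close>
    by (rule davis_kahan_aligned[OF _ _ _ assms(7,8,2,3,4,11)])
      (auto simp: assms(5,6) affinity_mat_symmetric)
  have "spectral_norm (V' - V * Q) \<le> 2 * (1 / \<alpha> * frobenius_norm (A - A'))"
    using spectral_norm_le_frobenius_norm[of "V' - V * Q"] bound by simp
  also have "\<dots> \<le> (1 + sqrt 2) * (1 / \<alpha> * frobenius_norm (A - A'))"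
    using \<open>\<alpha> > 0\<close> by (intro mult_right_mono) (auto simp: frobenius_norm_def)
  finally show ?thesis using Q by (auto simp: mult.assoc)
qed

end
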